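(* Let $\mathbf z^{LP}$ be an optimal fractional solution of the linear relaxation of the Assignment Problem under Fixed Representation (APFR). Solving the associated Flow-APFR problem yields a binary assignment $\bar{\mathbf z}$ of data points to clusters (each data point assigned to exactly one cluster) that satisfies the cardinality constraints $l\le\sum_{i}\bar z_{ik}\le u$ for all clusters $k$ and whose cost does not exceed the cost of the fractional solution: $\sum_{i,k}D(x^i,c_k)\bar z_{ik}\le\sum_{i,k}D(x^i,c_k)z^{LP}_{ik}$.
   Context: Setting. The data are $n$ indexed points $\mathcal X=\{x^1,\dots,x^n\}\subset\mathbb R^m$. There is a finite set $\mathcal F$ of sensitive features; each $f\in\mathcal F$ has a finite set of values $\mathcal G_f$, $\mathcal G=\bigcup_f\mathcal G_f$ is the set of groups, $X_g$ is the set of data points in group $g$, and $\{X_g\}_{g\in\mathcal G_f}$ partitions $\mathcal X$ for each $f$. $\mathcal K=\{1,\dots,K\}$ indexes the clusters, with fixed centers $c_1,\dots,c_K$ and assignment costs $D(x^i,c_k)$ (squared Euclidean distance for $k$-means, any given distance function for $k$-medians). $\alpha\in(0,1]$, and $1\le l\le u$ are integers. APFR. Given fixed $y_{gk}\in\{0,1\}$ ($y_{gk}=1$ means group $g$ must be $\alpha$-represented in cluster $k$), minimize $\sum_{i,k}D(x^i,c_k)z_{ik}$ subject to $\sum_k z_{ik}=1$ for all $i$; $\sum_{x^i\in X_g}z_{ik}\ge\alpha\sum_{x^i\in\mathcal X}z_{ik}$ for all $(g,k)$ with $y_{gk}=1$; $l\le\sum_{x^i\in\mathcal X}z_{ik}\le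 u$ for all $k$; $z_{ik}\in\{0,1\}$. Its linear relaxation replaces $z_{ik}\in\{0,1\}$ by $z_{ik}\in[0,1]$. Flow-APFR. For cluster $k$, let $\mathcal F_k$ be the set of features $f$ having some $g\in\mathcal G_f$ with $y_{gk}=1$. The set $T_k$ of types of cluster $k$ consists of all combinations obtained by choosing, for each $f\in\mathcal F_k$, either a group $g\in\mathcal G_f$ with $y_{gk}=1$ or, if there are groups in $\mathcal G_f$ with $y_{gk}=0$, the remainder value "none of the groups of $\mathcal G_f$ represented in $k$". For $t\in T_k$ let $X_t\subseteq\mathcal X$ be the set of data points matching $t$; the sets $X_t$, $t\in T_k$, partition $\mathcal X$. Given $\mathbf z^{LP}$, build a directed network with: - a node $v_i$ with supply $1$ for each $x^i\in\mathcal X$; - for each $k$ and $t\in T_k$ a node $v_{tk}$ with demand $d_{tk}=\lfloor\sum_{x^i\in X_t}z^{LP}_{ik}\rfloor$, and an edge $v_i\to v_{tk}$ of capacity $1$ and cost $D(x^i,c_k)$ for each $x^i\in X_t$; - for each $k$ a node $v_k$ with demand $d_k=\lfloor\sum_{x^i\in\mathcal X}z^{LP}_{ik}\rfloor-\sum_{t\in T_k}d_{tk}$, and an edge $v_{tk}\to v_k$ of capacity $1$ and cost $0$ for each $t\in T_k$; - a sink $v_s$ with demand $|\mathcal X|-\sum_k(d_k+\sum_{t\in T_k}d_{tk})$, and an edge $v_k\to v_s$ of capacity $1$ and cost $0$ for each $k$ with $\sum_{x^i\in\mathcal X}z^{LP}_{ik}\notin\mathbb Z$. The Flow-APFR problem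 is the minimum-cost flow problem on this network; solving it means computing an integral minimum-cost flow, which is read as the assignment $\bar z_{ik}=1$ if one unit flows from $v_i$ to some node $v_{tk}$, $t\in T_k$, and $\bar z_{ik}=0$ otherwise. *)

theory Defs
  imports "HOL-Analysis.Analysis"
begin

section \<open>Minimum-cost flow\<close>

text \<open>A demand is a negative net supply.\<close>

record 'v flow_network =
  nodes :: "'v set"
  edges :: "('v \<times> 'v) set"
  capacity :: "'v \<times> 'v \<Rightarrow> real"
  edge_cost :: "'v \<times> 'v \<Rightarrow> real"
  net_supply :: "'v \<Rightarrow> real"

definition feasible_flow :: "'v flow_network \<Rightarrow> ('v \<times> 'v \<Rightarrow> real) \<Rightarrow> bool" where
  "feasible_flow N \<phi> \<longleftrightarrow>
     (\<forall>e\<in>edges N. 0 \<le> \<phi> e \<and> \<phi> e \<le> capacity N e) \<and>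
     (\<forall>v\<in>nodes N. (\<Sum>e\<in>{e\<in>edges N. fst e = v}. \<phi> e) - (\<Sum>e\<in>{e\<in>edges N. snd e = v}. \<phi> e)
        = net_supply N v)"

definition flow_cost :: "'v flow_network \<Rightarrow> ('v \<times> 'v \<Rightarrow> real) \<Rightarrow> real" where
  "flow_cost N \<phi> = (\<Sum>e\<in>edges N. edge_cost N e * \<phi> e)"

definition min_cost_flow :: "'v flow_network \<Rightarrow> ('v \<times> 'v \<Rightarrow> real) \<Rightarrow> bool" where
  "min_cost_flow N \<phi> \<longleftrightarrow>
     feasible_flow N \<phi> \<and> (\<forall>\<psi>. feasible_flow N \<psi> \<longrightarrow> flow_cost N \<phi> \<le> flow_cost N \<psi>)"

definition integral_flow :: "'v flow_network \<Rightarrow> ('v \<times> 'v \<Rightarrow> real) \<Rightarrow> bool" where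
  "integral_flow N \<phi> \<longleftrightarrow> (\<forall>e\<in>edges N. \<phi> e \<in> \<int>)"


section \<open>Assignment under fixed representation\<close>

text \<open>Data points are identified with their indices \<open>1, \<dots>, num_points\<close>, so that coinciding
  points remain distinct data points; \<open>members g\<close> is the set of indices of the data points in
  group \<open>g\<close>.\<close>

record ('f, 'g, 'm::finite) apfr =
  num_points :: nat
  point :: "nat \<Rightarrow> real ^ 'm"
  num_clusters :: nat
  center :: "nat \<Rightarrow> real ^ 'm"
  distance :: "real ^ 'm \<Rightarrow> real ^ 'm \<Rightarrow> real"
  features :: "'f set"
  groups :: "'f \<Rightarrow> 'g set"
  members :: "'g \<Rightarrow> nat set"
  alpha :: real
  lower :: nat
  upper :: nat
  rep :: "'g \<Rightarrow> nat \<Rightarrow> nat"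

definition data_points :: "('f, 'g, 'm::finite) apfr \<Rightarrow> nat set" where
  "data_points I = {1..num_points I}"

definition clusters :: "('f, 'g, 'm::finite) apfr \<Rightarrow> nat set" where
  "clusters I = {1..num_clusters I}"

definition all_groups :: "('f, 'g, 'm::finite) apfr \<Rightarrow> 'g set" where
  "all_groups I = (\<Union>f\<in>features I. groups I f)"

text \<open>Of the assignment cost only nonnegativity is required: squared Euclidean distance is not
  a metric, and no further property of the given distance function is prescribed.\<close>

definition apfr_instance :: "('f, 'g, 'm::finite) apfr \<Rightarrow> bool" where
  "apfr_instance I \<longleftrightarrow>
     finite (features I) \<and>
     (\<forall>f\<in>features I. finite (groups I f)) \<and>
     (\<forall>f\<in>features I. disjoint_family_on (members I) (groups I f) \<and>
        (\<Union>g\<in>groups I f. members I g) = data_points I) \<and>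
     (\<forall>a b. 0 \<le> distance I a b) \<and>
     0 < alpha I \<and> alpha I \<le> 1 \<and>
     1 \<le> lower I \<and> lower I \<le> upper I \<and>
     (\<forall>g\<in>all_groups I. \<forall>k\<in>clusters I. rep I g k \<in> {0, 1})"

definition assignment_cost :: "('f, 'g, 'm::finite) apfr \<Rightarrow> (nat \<Rightarrow> nat \<Rightarrow> real) \<Rightarrow> real" where
  "assignment_cost I z =
     (\<Sum>i\<in>data_points I. \<Sum>k\<in>clusters I. distance I (point I i) (center I k) * z i k)"

text \<open>\<open>S\<close> is the range allowed for the variables: \<open>{0, 1}\<close> gives the assignment problem itself,
  \<open>{0..1}\<close> its linear relaxation.\<close>

definition apfr_feasible :: "('f, 'g, 'm::finite) apfr \<Rightarrow> real set \<Rightarrow> (nat \<Rightarrow> nat \<Rightarrow> real) \<Rightarrow> bool" where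
  "apfr_feasible I S z \<longleftrightarrow>
     (\<forall>i\<in>data_points I. (\<Sum>k\<in>clusters I. z i k) = 1) \<and>
     (\<forall>g\<in>all_groups I. \<forall>k\<in>clusters I. rep I g k = 1 \<longrightarrow>
        (\<Sum>i\<in>members I g. z i k) \<ge> alpha I * (\<Sum>i\<in>data_points I. z i k)) \<and>
     (\<forall>k\<in>clusters I. real (lower I) \<le> (\<Sum>i\<in>data_points I. z i k) \<and>
        (\<Sum>i\<in>data_points I. z i k) \<le> real (upper I)) \<and>
     (\<forall>i\<in>data_points I. \<forall>k\<in>clusters I. z i k \<in> S)"

definition lp_optimal :: "('f, 'g, 'm::finite) apfr \<Rightarrow> (nat \<Rightarrow> nat \<Rightarrow> real) \<Rightarrow> bool" where
  "lp_optimal I z \<longleftrightarrow> apfr_feasible I {0..1} z \<and>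
     (\<forall>z'. apfr_feasible I {0..1} z' \<longrightarrow> assignment_cost I z \<le> assignment_cost I z')"


section \<open>The flow network\<close>

text \<open>A type of cluster \<open>k\<close> maps each feature \<open>f\<close> having a group represented in \<open>k\<close> to \<open>Some g\<close>
  for a represented group \<open>g\<close> of \<open>f\<close>, or to \<open>None\<close>, the remainder value.\<close>

definition cluster_features :: "('f, 'g, 'm::finite) apfr \<Rightarrow> nat \<Rightarrow> 'f set" where
  "cluster_features I k = {f\<in>features I. \<exists>g\<in>groups I f. rep I g k = 1}"

definition types :: "('f, 'g, 'm::finite) apfr \<Rightarrow> nat \<Rightarrow> ('f \<Rightarrow> 'g option) set" where
  "types I k = (\<Pi>\<^sub>E f\<in>cluster_features I k.
     Some ` {g\<in>groups I f. rep I g k = 1} \<union> {None |g. g \<in> groups I f \<and> rep I g k = 0})"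

definition type_points :: "('f, 'g, 'm::finite) apfr \<Rightarrow> nat \<Rightarrow> ('f \<Rightarrow> 'g option) \<Rightarrow> nat set" where
  "type_points I k t = {i\<in>data_points I. \<forall>f\<in>cluster_features I k.
     (case t f of
        Some g \<Rightarrow> i \<in> members I g
      | None \<Rightarrow> \<forall>g\<in>groups I f. rep I g k = 1 \<longrightarrow> i \<notin> members I g)}"

datatype ('f, 'g) node =
    Point nat
  | TypeNode "'f \<Rightarrow> 'g option" nat
  | Cluster nat
  | Sink

definition type_demand ::
  "('f, 'g, 'm::finite) apfr \<Rightarrow> (nat \<Rightarrow> nat \<Rightarrow> real) \<Rightarrow> ('f \<Rightarrow> 'g option) \<Rightarrow> nat \<Rightarrow> int" where
  "type_demand I z t k = \<lfloor>\<Sum>i\<in>type_points I k t. z i k\<rfloor>"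

definition cluster_demand :: "('f, 'g, 'm::finite) apfr \<Rightarrow> (nat \<Rightarrow> nat \<Rightarrow> real) \<Rightarrow> nat \<Rightarrow> int" where
  "cluster_demand I z k =
     \<lfloor>\<Sum>i\<in>data_points I. z i k\<rfloor> - (\<Sum>t\<in>types I k. type_demand I z t k)"

definition sink_demand :: "('f, 'g, 'm::finite) apfr \<Rightarrow> (nat \<Rightarrow> nat \<Rightarrow> real) \<Rightarrow> int" where
  "sink_demand I z = int (card (data_points I)) -
     (\<Sum>k\<in>clusters I. cluster_demand I z k + (\<Sum>t\<in>types I k. type_demand I z t k))"

definition flow_apfr ::
  "('f, 'g, 'm::finite) apfr \<Rightarrow> (nat \<Rightarrow> nat \<Rightarrow> real) \<Rightarrow> ('f, 'g) node flow_network" where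
  "flow_apfr I z = \<lparr>
     nodes = {Point i |i. i \<in> data_points I}
       \<union> {TypeNode t k |t k. k \<in> clusters I \<and> t \<in> types I k}
       \<union> {Cluster k |k. k \<in> clusters I}
       \<union> {Sink},
     edges = {(Point i, TypeNode t k) |i t k.
           k \<in> clusters I \<and> t \<in> types I k \<and> i \<in> type_points I k t}
       \<union> {(TypeNode t k, Cluster k) |t k. k \<in> clusters I \<and> t \<in> types I k}
       \<union> {(Cluster k, Sink) |k. k \<in> clusters I \<and> (\<Sum>i\<in>data_points I. z i k) \<notin> \<int>},
     capacity = (\<lambda>e. 1),
     edge_cost = (\<lambda>e. case e of
         (Point i, TypeNode t k) \<Rightarrow> distance I (point I i) (center I k)
       | _ \<Rightarrow> 0),
     net_supply = (\<lambda>v. case v of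
         Point i \<Rightarrow> 1
       | TypeNode t k \<Rightarrow> - of_int (type_demand I z t k)
       | Cluster k \<Rightarrow> - of_int (cluster_demand I z k)
       | Sink \<Rightarrow> - of_int (sink_demand I z)) \<rparr>"

definition flow_assignment ::
  "('f, 'g, 'm::finite) apfr \<Rightarrow> (('f, 'g) node \<times> ('f, 'g) node \<Rightarrow> real) \<Rightarrow> nat \<Rightarrow> nat \<Rightarrow> real" where
  "flow_assignment I \<phi> i k =
     (if \<exists>t\<in>types I k. i \<in> type_points I k t \<and> \<phi> (Point i, TypeNode t k) = 1 then 1 else 0)"

end

theory Submission
  imports Defs
begin

text \<open>The network has integral capacities and integral demands, so it has an integral flow that is
  optimal even among all real flows, as soon as it has any feasible flow at all
  (\<open>integral_min_cost_flow_exists\<close>). The reason is that the fractional edges of a flow always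
  carry a nonzero circulation; following it in the direction that does not increase the cost makes
  more and more edges integral (\<open>circulation_on_fractional_edges\<close>, \<open>integral_flow_no_costlier\<close>).

  A feasible flow is provided by the fractional assignment itself: since all demands are its sums
  rounded down, sending its fractional parts on towards the sink meets them exactly
  (\<open>fractional_flow_feasible\<close>). As every data point has exactly one type in each cluster, a flow
  into the type nodes of a cluster is the same as an assignment to that cluster, and the cost of the
  flow is the cost of the assignment (\<open>flow_cost_flow_apfr\<close>). Hence the optimal integral flow
  costs at most as much as the fractional assignment.

  The cardinality bounds hold because conservation determines the size of each cluster up to the one
  unit that may leave for the sink, and this edge exists only if the fractional size is not an integer
  (\<open>cluster_size_of_flow\<close>). So the size is the fractional one rounded down or up, and the bounds,
  being integers, survive either rounding.\<close>

section \<open>Circulations on fractional edges\<close>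

text \<open>Gaussian elimination, one equation at a time: an equation with a nonzero coefficient
  is solved for that unknown, which is then substituted into all the others.\<close>

lemma nontrivial_solution_of_underdetermined_system:
  fixes a :: "'r \<Rightarrow> 'x \<Rightarrow> real"
  assumes "finite R" "finite X" "card R < card X"
  shows "\<exists>x. (\<exists>j\<in>X. x j \<noteq> 0) \<and> (\<forall>j. j \<notin> X \<longrightarrow> x j = 0) \<and> (\<forall>r\<in>R. (\<Sum>j\<in>X. a r j * x j) = 0)"
  using assms
proof (induction R arbitrary: X a rule: finite_induct)
  case empty
  then obtain p where "p \<in> X"
    by fastforce
  then show ?case
    by (intro exI[of _ "\<lambda>j. if j = p then 1 else 0"]) auto
next
  case (insert r R)
  show ?case
  proof (cases "\<forall>j\<in>X. a r j = 0")
    case True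
    obtain x where "\<exists>j\<in>X. x j \<noteq> 0" "\<forall>j. j \<notin> X \<longrightarrow> x j = 0" "\<forall>s\<in>R. (\<Sum>j\<in>X. a s j * x j) = 0"
      using insert.IH[of X a] insert.prems insert.hyps by auto
    with True show ?thesis
      by (intro exI[of _ x]) auto
  next
    case False
    then obtain p where p: "p \<in> X" "a r p \<noteq> 0"
      by blast
    define Y where "Y = X - {p}"
    have Y: "finite Y" "card R < card Y" "p \<notin> Y" "X = insert p Y"
      using insert.prems insert.hyps p by (auto simp: Y_def)
    obtain x where x: "\<exists>j\<in>Y. x j \<noteq> 0" "\<forall>j. j \<notin> Y \<longrightarrow> x j = 0"
      "\<forall>s\<in>R. (\<Sum>j\<in>Y. (a s j - a s p * a r j / a r p) * x j) = 0"
      using insert.IH[OF Y(1,2), of "\<lambda>s j. a s j - a s p * a r j / a r p"] by blast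
    \<comment> \<open>the value of the eliminated unknown that satisfies the equation \<open>r\<close>\<close>
    define c where "c = - (\<Sum>j\<in>Y. a r j * x j) / a r p"
    have split: "(\<Sum>j\<in>X. a s j * (x(p := c)) j) = a s p * c + (\<Sum>j\<in>Y. a s j * x j)" for s
    proof -
      have "(\<Sum>j\<in>Y. a s j * (x(p := c)) j) = (\<Sum>j\<in>Y. a s j * x j)"
        using Y(3) by (intro sum.cong) auto
      then show ?thesis
        using Y by simp
    qed
    have "(\<Sum>j\<in>X. a r j * (x(p := c)) j) = 0"
      unfolding split using p by (simp add: c_def)
    moreover have "(\<Sum>j\<in>X. a s j * (x(p := c)) j) = 0" if "s \<in> R" for s
    proof -
      have "0 = (\<Sum>j\<in>Y. a s j * x j - a s p / a r p * (a r j * x j))"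
        using x(3) that by (simp add: left_diff_distrib mult.assoc)
      also have "\<dots> = (\<Sum>j\<in>Y. a s j * x j) - a s p / a r p * (\<Sum>j\<in>Y. a r j * x j)"
        by (simp add: sum_subtractf sum_distrib_left)
      finally show ?thesis
        unfolding split by (simp add: c_def)
    qed
    moreover have "\<exists>j\<in>X. (x(p := c)) j \<noteq> 0"
      using x(1) Y(3,4) by (metis fun_upd_other insertCI)
    moreover have "\<forall>j. j \<notin> X \<longrightarrow> (x(p := c)) j = 0"
      using x(2) Y(4) by simp
    ultimately show ?thesis
      by (intro exI[of _ "x(p := c)"]) blast
  qed
qed

text \<open>The node-edge incidence matrix with the sign convention outflow minus inflow, so that the
  conservation law at \<open>v\<close> is one linear equation over all edges. A loop has a zero column.\<close>

definition incidence :: "'v \<Rightarrow> 'v \<times> 'v \<Rightarrow> real" where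
  "incidence v e = of_bool (fst e = v) - of_bool (snd e = v)"

lemma incidence_nonzero_iff:
  "fst e \<noteq> snd e \<Longrightarrow> incidence v e \<noteq> 0 \<longleftrightarrow> v \<in> {fst e, snd e}"
  by (auto simp: incidence_def)

lemma incidence_column_sum:
  assumes "finite V" "fst e \<in> V" "snd e \<in> V"
  shows "(\<Sum>v\<in>V. incidence v e) = 0"
  using assms by (simp add: incidence_def sum_subtractf of_bool_def)

lemma feasible_flow_incidence:
  assumes "finite (edges N)"
  shows "feasible_flow N \<phi> \<longleftrightarrow>
    (\<forall>e\<in>edges N. 0 \<le> \<phi> e \<and> \<phi> e \<le> capacity N e) \<and>
    (\<forall>v\<in>nodes N. (\<Sum>e\<in>edges N. incidence v e * \<phi> e) = net_supply N v)"
proof -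
  have "(\<Sum>e\<in>{e\<in>edges N. fst e = v}. \<phi> e) - (\<Sum>e\<in>{e\<in>edges N. snd e = v}. \<phi> e)
      = (\<Sum>e\<in>edges N. incidence v e * \<phi> e)" for v
    using assms
    by (simp add: incidence_def left_diff_distrib sum_subtractf sum.inter_filter of_bool_def
        if_distrib[of "\<lambda>x. x * _"] cong: if_cong)
  then show ?thesis
    unfolding feasible_flow_def by simp
qed

text \<open>Conservation on \<open>F\<close> is a homogeneous linear system with one unknown per edge and one
  equation per endpoint. If every endpoint meets at least two edges, counting the ends of edges shows
  that there are at most as many equations as unknowns. Since every column of the incidence matrix
  sums to zero, one equation follows from the others, and dropping it leaves strictly fewer equations
  than unknowns.\<close>

lemma circulation_if_no_leaves:
  fixes F :: "('v \<times> 'v) set"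
  assumes "finite F" "F \<noteq> {}"
    and loopfree: "\<forall>e\<in>F. fst e \<noteq> snd e"
    and deg: "\<And>e v. e \<in> F \<Longrightarrow> incidence v e \<noteq> 0 \<Longrightarrow> \<exists>e'\<in>F. e' \<noteq> e \<and> incidence v e' \<noteq> 0"
  shows "\<exists>\<delta>. (\<exists>e\<in>F. \<delta> e \<noteq> 0) \<and> (\<forall>e. e \<notin> F \<longrightarrow> \<delta> e = 0) \<and>
    (\<forall>v. (\<Sum>e\<in>F. incidence v e * \<delta> e) = 0)"
proof -
  define V where "V = fst ` F \<union> snd ` F"
  have "finite V"
    using \<open>finite F\<close> by (simp add: V_def)
  have two: "2 \<le> card {e\<in>F. incidence v e \<noteq> 0}" if v: "v \<in> V" for v
  proof -
    obtain e where e: "e \<in> F" "incidence v e \<noteq> 0"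
      using v loopfree by (fastforce simp: V_def incidence_nonzero_iff)
    then obtain e' where e': "e' \<in> F" "e' \<noteq> e" "incidence v e' \<noteq> 0"
      using deg by blast
    have "card {e, e'} \<le> card {e\<in>F. incidence v e \<noteq> 0}"
      using e e' \<open>finite F\<close> by (intro card_mono) auto
    then show ?thesis
      using e' by simp
  qed
  have ends: "card {v\<in>V. incidence v e \<noteq> 0} = 2" if "e \<in> F" for e
  proof -
    have "{v\<in>V. incidence v e \<noteq> 0} = {fst e, snd e}"
      using that loopfree by (auto simp: V_def incidence_nonzero_iff)
    then show ?thesis
      using that loopfree by simp
  qed
  have "2 * card V \<le> (\<Sum>v\<in>V. card {e\<in>F. incidence v e \<noteq> 0})"
    using sum_mono[of V "\<lambda>_. 2" "\<lambda>v. card {e\<in>F. incidence v e \<noteq> 0}"] two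
    by (simp add: mult.commute)
  also have "\<dots> = 2 * card F"
    using sum_multicount[OF \<open>finite V\<close> \<open>finite F\<close>, of "\<lambda>v e. incidence v e \<noteq> 0" 2] ends by simp
  finally have le: "card V \<le> card F"
    by simp
  obtain w where w: "w \<in> V"
    using \<open>F \<noteq> {}\<close> by (auto simp: V_def)
  have "card (V - {w}) < card F"
    using le w \<open>finite V\<close> by (metis card_Diff1_less order_less_le_trans)
  then obtain \<delta> where \<delta>: "\<exists>e\<in>F. \<delta> e \<noteq> 0" "\<forall>e. e \<notin> F \<longrightarrow> \<delta> e = 0"
    "\<forall>v\<in>V - {w}. (\<Sum>e\<in>F. incidence v e * \<delta> e) = 0"
    using nontrivial_solution_of_underdetermined_system[of "V - {w}" F incidence]
      \<open>finite V\<close> \<open>finite F\<close> by auto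
  have "(\<Sum>v\<in>V. \<Sum>e\<in>F. incidence v e * \<delta> e) = (\<Sum>e\<in>F. (\<Sum>v\<in>V. incidence v e) * \<delta> e)"
    by (subst sum.swap) (simp add: sum_distrib_right)
  also have "\<dots> = 0"
    using incidence_column_sum[OF \<open>finite V\<close>] by (intro sum.neutral) (auto simp: V_def)
  finally have "(\<Sum>e\<in>F. incidence w e * \<delta> e) = 0"
    using \<delta>(3) w \<open>finite V\<close> by (simp add: sum.remove[of V w])
  moreover have "(\<Sum>e\<in>F. incidence v e * \<delta> e) = 0" if "v \<notin> V" for v
    using that by (intro sum.neutral) (auto simp: V_def incidence_def)
  ultimately show ?thesis
    using \<delta> by (intro exI[of _ \<delta>]) (metis DiffI singletonD)
qed

text \<open>A fractional loop carries a circulation by itself. Without loops, a node whose net outflow is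
  an integer cannot meet exactly one fractional edge, because all the other terms of its balance
  would be integers. So the fractional edges form a subgraph without leaves.\<close>

lemma circulation_on_fractional_edges:
  fixes E :: "('v \<times> 'v) set" and \<phi> :: "'v \<times> 'v \<Rightarrow> real"
  assumes "finite E"
    and net: "\<forall>e\<in>E. \<forall>v\<in>{fst e, snd e}. (\<Sum>e\<in>E. incidence v e * \<phi> e) \<in> \<int>"
    and frac: "e\<^sub>0 \<in> E" "\<phi> e\<^sub>0 \<notin> \<int>"
  shows "\<exists>\<delta>. (\<exists>e\<in>E. \<delta> e \<noteq> 0) \<and> (\<forall>e. e \<notin> E \<or> \<phi> e \<in> \<int> \<longrightarrow> \<delta> e = 0) \<and>
    (\<forall>v. (\<Sum>e\<in>E. incidence v e * \<delta> e) = 0)"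
proof -
  define F where "F = {e\<in>E. \<phi> e \<notin> \<int>}"
  have F: "finite F" "F \<noteq> {}" "F \<subseteq> E"
    unfolding F_def using \<open>finite E\<close> frac by (simp, blast, blast)
  have "\<exists>\<delta>. (\<exists>e\<in>F. \<delta> e \<noteq> 0) \<and> (\<forall>e. e \<notin> F \<longrightarrow> \<delta> e = 0) \<and>
    (\<forall>v. (\<Sum>e\<in>F. incidence v e * \<delta> e) = 0)"
  proof (cases "\<exists>e\<in>F. fst e = snd e")
    case True
    then obtain e where e: "e \<in> F" "fst e = snd e"
      by blast
    then show ?thesis
      by (intro exI[of _ "\<lambda>e'. if e' = e then 1 else 0"]) (auto intro!: sum.neutral simp: incidence_def)
  next
    case False
    have "\<exists>e'\<in>F. e' \<noteq> e \<and> incidence v e' \<noteq> 0" if e: "e \<in> F" "incidence v e \<noteq> 0" for e v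
    proof (rule ccontr)
      assume leaf: "\<not> ?thesis"
      have "incidence v e' * \<phi> e' \<in> \<int>" if "e' \<in> E - {e}" for e'
      proof (cases "e' \<in> F")
        case True
        then have "incidence v e' = 0"
          using leaf that by blast
        then show ?thesis
          by simp
      next
        case False
        then have "\<phi> e' \<in> \<int>"
          using that by (simp add: F_def)
        then show ?thesis
          by (simp add: incidence_def)
      qed
      then have "(\<Sum>e\<in>E - {e}. incidence v e * \<phi> e) \<in> \<int>"
        by (rule Ints_sum)
      moreover have "(\<Sum>e\<in>E. incidence v e * \<phi> e) \<in> \<int>"
      proof -
        have "e \<in> E" "v \<in> {fst e, snd e}"
          using e by (auto simp: F_def incidence_def split: if_splits)
        then show ?thesis
          using net by blast
      qed
      moreover have "(\<Sum>e\<in>E. incidence v e * \<phi> e)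
          = incidence v e * \<phi> e + (\<Sum>e\<in>E - {e}. incidence v e * \<phi> e)"
        using e F \<open>finite E\<close> by (intro sum.remove) auto
      ultimately have "incidence v e * \<phi> e \<in> \<int>"
        by (metis Ints_diff add_diff_cancel_right')
      moreover have "incidence v e = 1 \<or> incidence v e = -1"
        using e(2) by (auto simp: incidence_def of_bool_def split: if_splits)
      ultimately show False
        using e(1) by (auto simp: F_def)
    qed
    then show ?thesis
      using circulation_if_no_leaves[of F] F(1,2) False by blast
  qed
  then obtain \<delta> where \<delta>: "\<exists>e\<in>F. \<delta> e \<noteq> 0" "\<forall>e. e \<notin> F \<longrightarrow> \<delta> e = 0"
    "\<forall>v. (\<Sum>e\<in>F. incidence v e * \<delta> e) = 0"
    by blast
  have "(\<Sum>e\<in>E. incidence v e * \<delta> e) = (\<Sum>e\<in>F. incidence v e * \<delta> e)" for v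
    using \<delta>(2) F(3) \<open>finite E\<close> by (intro sum.mono_neutral_right) auto
  then show ?thesis
    using \<delta> F(3) by (intro exI[of _ \<delta>]) (auto simp: F_def)
qed

section \<open>Rounding a flow to an integral one\<close>

text \<open>The step length is the smallest one that takes some coordinate to the integer next to it
  in its direction of travel; by minimality no coordinate has overshot its own.\<close>

lemma step_to_first_integer:
  fixes \<phi> \<delta> :: "'e \<Rightarrow> real"
  assumes "finite F" "e\<^sub>0 \<in> F" "\<delta> e\<^sub>0 \<noteq> 0" "\<And>e. e \<in> F \<Longrightarrow> \<phi> e \<in> \<int> \<Longrightarrow> \<delta> e = 0"
  shows "\<exists>t\<ge>0. (\<forall>e\<in>F. of_int \<lfloor>\<phi> e\<rfloor> \<le> \<phi> e + t * \<delta> e \<and> \<phi> e + t * \<delta> e \<le> of_int \<lceil>\<phi> e\<rceil>) \<and>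
    (\<exists>e\<in>F. \<phi> e \<notin> \<int> \<and> \<phi> e + t * \<delta> e \<in> \<int>)"
proof -
  define s where "s e = (if \<delta> e > 0 then (of_int \<lceil>\<phi> e\<rceil> - \<phi> e) / \<delta> e else (of_int \<lfloor>\<phi> e\<rfloor> - \<phi> e) / \<delta> e)" for e
  define G where "G = {e\<in>F. \<delta> e \<noteq> 0}"
  have G: "finite G" "G \<noteq> {}"
    using assms by (auto simp: G_def)
  define t where "t = Min (s ` G)"
  have s0: "0 \<le> s e" for e
    by (simp add: s_def divide_nonneg_pos divide_nonpos_neg divide_nonpos_nonpos)
  have le: "t \<le> s e" if "e \<in> G" for e
    using that G by (simp add: t_def)
  have "t \<in> s ` G"
    unfolding t_def using G by (intro Min_in) auto
  then obtain e where e: "e \<in> G" "t = s e"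
    by blast
  have t0: "0 \<le> t"
    using e s0 by simp
  have "of_int \<lfloor>\<phi> e\<rfloor> \<le> \<phi> e + t * \<delta> e \<and> \<phi> e + t * \<delta> e \<le> of_int \<lceil>\<phi> e\<rceil>" if "e \<in> F" for e
  proof -
    consider "\<delta> e = 0" | "\<delta> e > 0" | "\<delta> e < 0"
      by linarith
    then show ?thesis
    proof cases
      case 2
      then have "t * \<delta> e \<le> of_int \<lceil>\<phi> e\<rceil> - \<phi> e"
        using le[of e] that by (simp add: G_def s_def pos_le_divide_eq)
      moreover have "0 \<le> t * \<delta> e"
        using 2 t0 by simp
      ultimately show ?thesis
        by linarith
    next
      case 3
      then have "t * \<delta> e \<ge> of_int \<lfloor>\<phi> e\<rfloor> - \<phi> e"
        using le[of e] that by (simp add: G_def s_def neg_le_divide_eq)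
      moreover have "t * \<delta> e \<le> 0"
        using 3 t0 by (simp add: mult_nonneg_nonpos)
      ultimately show ?thesis
        by linarith
    qed auto
  qed
  moreover have "\<phi> e + t * \<delta> e \<in> \<int>"
    using e by (auto simp: s_def G_def)
  moreover have "e \<in> F" "\<phi> e \<notin> \<int>"
    using e assms(4) by (auto simp: G_def)
  ultimately show ?thesis
    using t0 by blast
qed

text \<open>A circulation on the fractional edges can be reversed, so one of its two directions does not
  increase the cost. Following it until an edge becomes integral keeps every edge value between its
  floor and its ceiling, hence within the integral capacity bounds, and leaves the already integral
  edges untouched. The number of fractional edges drops, so the process ends with an integral flow.\<close>

lemma integral_flow_no_costlier:
  fixes N :: "'v flow_network"
  assumes fin: "finite (edges N)"
    and inc: "edges N \<subseteq> nodes N \<times> nodes N"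
    and cap: "\<forall>e\<in>edges N. capacity N e \<in> \<int>"
    and sup: "\<forall>v\<in>nodes N. net_supply N v \<in> \<int>"
    and "feasible_flow N \<phi>"
  shows "\<exists>\<psi>. feasible_flow N \<psi> \<and> integral_flow N \<psi> \<and> flow_cost N \<psi> \<le> flow_cost N \<phi>"
  using \<open>feasible_flow N \<phi>\<close>
proof (induction "card {e\<in>edges N. \<phi> e \<notin> \<int>}" arbitrary: \<phi> rule: less_induct)
  case less
  note feas = less.prems[unfolded feasible_flow_incidence[OF fin]]
  show ?case
  proof (cases "integral_flow N \<phi>")
    case True
    with less.prems show ?thesis
      by blast
  next
    case False
    then obtain e\<^sub>0 where e0: "e\<^sub>0 \<in> edges N" "\<phi> e\<^sub>0 \<notin> \<int>"
      by (auto simp: integral_flow_def)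
    have "\<forall>e\<in>edges N. \<forall>v\<in>{fst e, snd e}. (\<Sum>e\<in>edges N. incidence v e * \<phi> e) \<in> \<int>"
      using feas inc sup by fastforce
    then obtain \<delta> where \<delta>: "\<exists>e\<in>edges N. \<delta> e \<noteq> 0"
      "\<forall>e. e \<notin> edges N \<or> \<phi> e \<in> \<int> \<longrightarrow> \<delta> e = 0"
      "\<forall>v. (\<Sum>e\<in>edges N. incidence v e * \<delta> e) = 0"
      using circulation_on_fractional_edges[where \<phi> = \<phi>, OF fin _ e0] by blast
    \<comment> \<open>the sign that makes the direction of change not increase the cost\<close>
    define \<sigma> :: real where "\<sigma> = (if flow_cost N \<delta> \<le> 0 then 1 else -1)"
    define \<gamma> where "\<gamma> e = \<sigma> * \<delta> e" for e
    have \<gamma>: "\<exists>e\<in>edges N. \<gamma> e \<noteq> 0" "\<forall>e\<in>edges N. \<phi> e \<in> \<int> \<longrightarrow> \<gamma> e = 0"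
      using \<delta> by (auto simp: \<gamma>_def \<sigma>_def)
    have \<gamma>_net: "(\<Sum>e\<in>edges N. incidence v e * \<gamma> e) = 0" for v
      using \<delta>(3) by (simp add: \<gamma>_def mult.left_commute flip: sum_distrib_left)
    have "flow_cost N \<gamma> = \<sigma> * flow_cost N \<delta>"
      by (simp add: \<gamma>_def flow_cost_def sum_distrib_left mult.left_commute)
    then have \<gamma>_cost: "flow_cost N \<gamma> \<le> 0"
      by (simp add: \<sigma>_def)
    obtain t where t: "t \<ge> 0"
      "\<forall>e\<in>edges N. of_int \<lfloor>\<phi> e\<rfloor> \<le> \<phi> e + t * \<gamma> e \<and> \<phi> e + t * \<gamma> e \<le> of_int \<lceil>\<phi> e\<rceil>"
      "\<exists>e\<in>edges N. \<phi> e \<notin> \<int> \<and> \<phi> e + t * \<gamma> e \<in> \<int>"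
      using step_to_first_integer[OF fin, of _ \<gamma> \<phi>] \<gamma> by blast
    define \<phi>' where "\<phi>' e = \<phi> e + t * \<gamma> e" for e
    have "0 \<le> \<phi>' e \<and> \<phi>' e \<le> capacity N e" if e: "e \<in> edges N" for e
    proof -
      have "0 \<le> \<lfloor>\<phi> e\<rfloor>"
        using feas e by simp
      then have "0 \<le> real_of_int \<lfloor>\<phi> e\<rfloor>"
        by simp
      moreover obtain c where c: "capacity N e = of_int c"
        using cap e by (auto elim: Ints_cases)
      then have "\<lceil>\<phi> e\<rceil> \<le> c"
        using feas e by (metis ceiling_le_iff)
      then have "real_of_int \<lceil>\<phi> e\<rceil> \<le> capacity N e"
        by (simp add: c)
      ultimately show ?thesis
        using t(2) e unfolding \<phi>'_def by (meson order_trans)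
    qed
    moreover have "(\<Sum>e\<in>edges N. incidence v e * \<phi>' e) = net_supply N v" if "v \<in> nodes N" for v
    proof -
      have "(\<Sum>e\<in>edges N. incidence v e * \<phi>' e)
          = (\<Sum>e\<in>edges N. incidence v e * \<phi> e) + t * (\<Sum>e\<in>edges N. incidence v e * \<gamma> e)"
        by (simp add: \<phi>'_def algebra_simps sum.distrib sum_distrib_left)
      then show ?thesis
        using feas that by (simp add: \<gamma>_net)
    qed
    ultimately have feas': "feasible_flow N \<phi>'"
      by (simp add: feasible_flow_incidence[OF fin])
    have "flow_cost N \<phi>' = flow_cost N \<phi> + t * flow_cost N \<gamma>"
      by (simp add: \<phi>'_def flow_cost_def algebra_simps sum.distrib sum_distrib_left)
    then have cost': "flow_cost N \<phi>' \<le> flow_cost N \<phi>"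
      using t(1) \<gamma>_cost by (simp add: mult_nonneg_nonpos)
    have "{e\<in>edges N. \<phi>' e \<notin> \<int>} \<subset> {e\<in>edges N. \<phi> e \<notin> \<int>}"
      using \<gamma>(2) t(3) by (force simp: \<phi>'_def)
    then have "card {e\<in>edges N. \<phi>' e \<notin> \<int>} < card {e\<in>edges N. \<phi> e \<notin> \<int>}"
      using fin by (intro psubset_card_mono) auto
    from less.hyps[OF this feas'] show ?thesis
      using cost' by (meson order_trans)
  qed
qed

text \<open>Bounded capacities admit only finitely many integral flows up to their values off the edges,
  so a cheapest one exists. It is optimal among all flows because each of them can be rounded to an
  integral flow that is no costlier.\<close>

lemma integral_min_cost_flow_exists:
  fixes N :: "'v flow_network"
  assumes fin: "finite (edges N)"
    and inc: "edges N \<subseteq> nodes N \<times> nodes N"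
    and cap: "\<forall>e\<in>edges N. capacity N e \<in> \<int>"
    and sup: "\<forall>v\<in>nodes N. net_supply N v \<in> \<int>"
    and "feasible_flow N \<phi>\<^sub>0"
  shows "\<exists>\<phi>. min_cost_flow N \<phi> \<and> integral_flow N \<phi>"
proof -
  define P where "P \<phi> \<longleftrightarrow> feasible_flow N \<phi> \<and> integral_flow N \<phi>" for \<phi>
  define B where "B = (\<Pi>\<^sub>E e\<in>edges N. {x\<in>\<int>. 0 \<le> x \<and> x \<le> capacity N e})"
  have "finite B"
    unfolding B_def using fin by (intro finite_PiE finite_int_segment)
  moreover have "flow_cost N \<phi> \<in> flow_cost N ` B" if "P \<phi>" for \<phi>
  proof
    show "flow_cost N \<phi> = flow_cost N (restrict \<phi> (edges N))"
      by (simp add: flow_cost_def)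
    show "restrict \<phi> (edges N) \<in> B"
      using that by (auto simp: P_def B_def feasible_flow_def integral_flow_def)
  qed
  ultimately have "finite (flow_cost N ` Collect P)"
    by (blast intro: finite_subset)
  moreover have "Collect P \<noteq> {}"
    using integral_flow_no_costlier[OF assms] by (auto simp: P_def)
  ultimately obtain \<phi> where \<phi>: "P \<phi>" "\<And>\<psi>. P \<psi> \<Longrightarrow> flow_cost N \<phi> \<le> flow_cost N \<psi>"
    using Min_in[of "flow_cost N ` Collect P"] Min_le[of "flow_cost N ` Collect P"] by (smt (verit) image_iff image_is_empty imageI mem_Collect_eq)
  have "flow_cost N \<phi> \<le> flow_cost N \<psi>" if "feasible_flow N \<psi>" for \<psi>
    using integral_flow_no_costlier[OF fin inc cap sup that] \<phi>(2) unfolding P_def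
    by (meson order_trans)
  then show ?thesis
    using \<phi>(1) by (auto simp: P_def min_cost_flow_def)
qed

section \<open>Partition of the data points by types\<close>

text \<open>The type of cluster \<open>k\<close> that the data point \<open>i\<close> matches. Choosing it explicitly turns the
  statement that the sets \<open>type_points\<close> partition the data points into the statement that they are
  the fibres of a function.\<close>

definition type_of :: "('f, 'g, 'm::finite) apfr \<Rightarrow> nat \<Rightarrow> nat \<Rightarrow> 'f \<Rightarrow> 'g option" where
  "type_of I k i = (\<lambda>f\<in>cluster_features I k.
     if \<exists>g\<in>groups I f. rep I g k = 1 \<and> i \<in> members I g
     then Some (THE g. g \<in> groups I f \<and> i \<in> members I g) else None)"

lemma the_group:
  assumes "apfr_instance I" "f \<in> features I" "g \<in> groups I f" "i \<in> members I g"
  shows "(THE g. g \<in> groups I f \<and> i \<in> members I g) = g"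
  using assms unfolding apfr_instance_def disjoint_family_on_def by (intro the_equality) blast+

text \<open>The remainder value is admissible whenever it is chosen: if no represented group of the
  feature contains \<open>i\<close>, then the group that does contain \<open>i\<close> is not represented.\<close>

lemma type_of_in_types:
  assumes I: "apfr_instance I" and i: "i \<in> data_points I" and k: "k \<in> clusters I"
  shows "type_of I k i \<in> types I k"
  unfolding types_def
proof (rule PiE_I)
  fix f assume f: "f \<in> cluster_features I k"
  then have f': "f \<in> features I"
    by (simp add: cluster_features_def)
  have "(\<Union>g\<in>groups I f. members I g) = data_points I"
    using I f' by (simp add: apfr_instance_def)
  then obtain g where g: "g \<in> groups I f" "i \<in> members I g"
    using i by blast
  have "rep I g k \<in> {0, 1}"
    using I f' g k unfolding apfr_instance_def all_groups_def by blast
  then show "type_of I k i f \<in> Some ` {g\<in>groups I f. rep I g k = 1} \<union> {None |g. g \<in> groups I f \<and> rep I g k = 0}"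
    using f g the_group[OF I f'] by (auto simp: type_of_def)
qed (simp add: type_of_def)

lemma type_points_iff_type_of:
  assumes I: "apfr_instance I" and t: "t \<in> types I k" and i: "i \<in> data_points I"
  shows "i \<in> type_points I k t \<longleftrightarrow> type_of I k i = t"
proof
  assume L: "i \<in> type_points I k t"
  show "type_of I k i = t"
  proof
    fix f
    show "type_of I k i f = t f"
    proof (cases "f \<in> cluster_features I k")
      case False
      then show ?thesis
        using t by (simp add: type_of_def types_def PiE_arb[of t])
    next
      case True
      then have f: "f \<in> features I"
        by (simp add: cluster_features_def)
      have tf: "t f \<in> Some ` {g\<in>groups I f. rep I g k = 1} \<union> {None |g. g \<in> groups I f \<and> rep I g k = 0}"
        using t True unfolding types_def by (rule PiE_mem)
      show ?thesis
      proof (cases "t f")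
        case None
        then show ?thesis
          using L True by (auto simp: type_points_def type_of_def)
      next
        case (Some g)
        then have "g \<in> groups I f" "rep I g k = 1" "i \<in> members I g"
          using L True tf by (auto simp: type_points_def)
        then show ?thesis
          using Some True the_group[OF I f] by (auto simp: type_of_def)
      qed
    qed
  qed
next
  assume R: "type_of I k i = t"
  have "case type_of I k i f of Some g \<Rightarrow> i \<in> members I g
      | None \<Rightarrow> \<forall>g\<in>groups I f. rep I g k = 1 \<longrightarrow> i \<notin> members I g"
    if f: "f \<in> cluster_features I k" for f
  proof -
    have "f \<in> features I"
      using f by (simp add: cluster_features_def)
    then show ?thesis
      using f the_group[OF I] by (auto simp: type_of_def)
  qed
  then show "i \<in> type_points I k t"
    using i by (simp add: type_points_def R)
qed

lemma type_points_eq: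
  assumes "apfr_instance I" "t \<in> types I k"
  shows "type_points I k t = {i\<in>data_points I. type_of I k i = t}"
proof -
  have "type_points I k t \<subseteq> data_points I"
    by (auto simp: type_points_def)
  then show ?thesis
    using type_points_iff_type_of[OF assms] by blast
qed

lemma finite_data_points [simp]: "finite (data_points I)"
  and finite_clusters [simp]: "finite (clusters I)"
  by (simp_all add: data_points_def clusters_def)

lemma finite_types:
  assumes "apfr_instance I"
  shows "finite (types I k)"
  unfolding types_def
proof (intro finite_PiE finite_UnI finite_imageI)
  show "finite (cluster_features I k)"
    using assms by (simp add: apfr_instance_def cluster_features_def)
next
  fix f assume "f \<in> cluster_features I k"
  then show "finite {g\<in>groups I f. rep I g k = 1}"
    using assms by (simp add: apfr_instance_def cluster_features_def)
  show "finite {None |g. g \<in> groups I f \<and> rep I g k = 0}"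
    by (rule finite_subset[of _ "{None}"]) auto
qed

lemma sum_over_types:
  assumes I: "apfr_instance I" and k: "k \<in> clusters I"
  shows "(\<Sum>t\<in>types I k. \<Sum>i\<in>type_points I k t. h i) = (\<Sum>i\<in>data_points I. h i)"
proof -
  have "(\<Sum>t\<in>types I k. \<Sum>i\<in>type_points I k t. h i)
      = (\<Sum>t\<in>types I k. \<Sum>i\<in>{i\<in>data_points I. type_of I k i = t}. h i)"
    using type_points_eq[OF I] by (intro sum.cong) auto
  also have "\<dots> = (\<Sum>i\<in>data_points I. h i)"
    using type_of_in_types[OF I _ k] finite_types[OF I] by (intro sum.group) auto
  finally show ?thesis .
qed

section \<open>The conservation laws of the network\<close>

definition point_edge ::
  "('f, 'g, 'm::finite) apfr \<Rightarrow> nat \<Rightarrow> nat \<Rightarrow> ('f, 'g) node \<times> ('f, 'g) node" where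
  "point_edge I i k = (Point i, TypeNode (type_of I k i) k)"

text \<open>The clusters that have an edge to the sink.\<close>

abbreviation frac_clusters :: "('f, 'g, 'm::finite) apfr \<Rightarrow> (nat \<Rightarrow> nat \<Rightarrow> real) \<Rightarrow> nat set" where
  "frac_clusters I z \<equiv> {k\<in>clusters I. (\<Sum>i\<in>data_points I. z i k) \<notin> \<int>}"

text \<open>Between a data point and the type nodes of a fixed cluster there is exactly one edge, so
  the first layer is indexed by pairs of a point and a cluster rather than by triples with a type.\<close>

lemma edges_flow_apfr:
  assumes I: "apfr_instance I"
  shows "edges (flow_apfr I z) =
    (\<lambda>(i, k). point_edge I i k) ` (data_points I \<times> clusters I)
    \<union> (\<lambda>(k, t). (TypeNode t k, Cluster k)) ` (SIGMA k:clusters I. types I k)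
    \<union> (\<lambda>k. (Cluster k, Sink)) ` frac_clusters I z"
proof -
  have "{(Point i, TypeNode t k) |i t k. k \<in> clusters I \<and> t \<in> types I k \<and> i \<in> type_points I k t}
    = (\<lambda>(i, k). point_edge I i k) ` (data_points I \<times> clusters I)"
    using type_of_in_types[OF I] by (force simp: type_points_eq[OF I] point_edge_def)
  then show ?thesis
    unfolding flow_apfr_def flow_network.select_convs
    by (intro arg_cong2[where f = "(\<union>)"]) force+
qed

lemma finite_edges_flow_apfr:
  "apfr_instance I \<Longrightarrow> finite (edges (flow_apfr I z))"
  unfolding edges_flow_apfr by (intro finite_UnI finite_imageI finite_SigmaI) (simp_all add: finite_types)

lemma sum_edges_flow_apfr:
  assumes I: "apfr_instance I"
  shows "(\<Sum>e\<in>edges (flow_apfr I z). h e) =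
    (\<Sum>i\<in>data_points I. \<Sum>k\<in>clusters I. h (point_edge I i k))
    + (\<Sum>k\<in>clusters I. \<Sum>t\<in>types I k. h (TypeNode t k, Cluster k))
    + (\<Sum>k\<in>frac_clusters I z. h (Cluster k, Sink))"
proof -
  have "(\<Sum>e\<in>edges (flow_apfr I z). h e) =
      sum h ((\<lambda>(i, k). point_edge I i k) ` (data_points I \<times> clusters I))
    + sum h ((\<lambda>(k, t). (TypeNode t k, Cluster k)) ` (SIGMA k:clusters I. types I k))
    + sum h ((\<lambda>k. (Cluster k, Sink)) ` frac_clusters I z)"
    unfolding edges_flow_apfr[OF I] using finite_types[OF I]
    by (subst sum.union_disjoint; (subst sum.union_disjoint)?) (auto simp: point_edge_def)
  moreover have "sum h ((\<lambda>(i, k). point_edge I i k) ` (data_points I \<times> clusters I)) =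
      (\<Sum>i\<in>data_points I. \<Sum>k\<in>clusters I. h (point_edge I i k))"
    by (subst sum.reindex) (auto simp: inj_on_def point_edge_def sum.cartesian_product case_prod_unfold)
  moreover have "sum h ((\<lambda>(k, t). (TypeNode t k, Cluster k)) ` (SIGMA k:clusters I. types I k)) =
      (\<Sum>k\<in>clusters I. \<Sum>t\<in>types I k. h (TypeNode t k, Cluster k))"
    using finite_types[OF I]
    by (subst sum.reindex) (auto simp: inj_on_def sum.Sigma case_prod_unfold)
  moreover have "sum h ((\<lambda>k. (Cluster k, Sink)) ` frac_clusters I z)
      = (\<Sum>k\<in>frac_clusters I z. h (Cluster k, Sink))"
    by (subst sum.reindex) (auto simp: inj_on_def)
  ultimately show ?thesis
    by simp
qed

lemma sum_of_bool_const_mult: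
  "(\<Sum>x\<in>A. of_bool b * f x) = (if b then \<Sum>x\<in>A. f x else (0::real))"
  by simp

lemma incidence_flow_apfr:
  "incidence (Point i) (point_edge I j k) = of_bool (j = i)"
  "incidence (Point i) (TypeNode t k, Cluster k) = 0"
  "incidence (Point i) (Cluster k, Sink) = 0"
  "incidence (TypeNode t k) (point_edge I j k') = of_bool (k' = k) * - of_bool (type_of I k j = t)"
  "incidence (TypeNode t k) (TypeNode t' k', Cluster k') = of_bool (k' = k) * of_bool (t' = t)"
  "incidence (TypeNode t k) (Cluster k', Sink) = 0"
  "incidence (Cluster k) (point_edge I j k') = 0"
  "incidence (Cluster k) (TypeNode t' k', Cluster k') = of_bool (k' = k) * -1"
  "incidence (Cluster k) (Cluster k', Sink) = of_bool (k' = k)"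
  "incidence Sink (point_edge I j k) = 0"
  "incidence Sink (TypeNode t k, Cluster k) = 0"
  "incidence Sink (Cluster k, Sink) = -1"
  by (auto simp: incidence_def point_edge_def)

lemma net_outflow_Point:
  assumes I: "apfr_instance I" and i: "i \<in> data_points I"
  shows "(\<Sum>e\<in>edges (flow_apfr I z). incidence (Point i) e * \<phi> e)
    = (\<Sum>k\<in>clusters I. \<phi> (point_edge I i k))"
  using i unfolding sum_edges_flow_apfr[OF I] incidence_flow_apfr sum_of_bool_const_mult
  by simp

lemma net_outflow_TypeNode:
  assumes I: "apfr_instance I" and k: "k \<in> clusters I" and t: "t \<in> types I k"
  shows "(\<Sum>e\<in>edges (flow_apfr I z). incidence (TypeNode t k) e * \<phi> e)
    = \<phi> (TypeNode t k, Cluster k) - (\<Sum>i\<in>type_points I k t. \<phi> (point_edge I i k))"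
proof -
  have "(\<Sum>k'\<in>clusters I. of_bool (k' = k) * (- of_bool (type_of I k i = t) * \<phi> (point_edge I i k')))
      = - (if type_of I k i = t then \<phi> (point_edge I i k) else 0)" for i
    using k by (simp add: of_bool_def if_distrib[of "\<lambda>x. x * _"] sum_negf cong: if_cong)
  moreover have "(\<Sum>t'\<in>types I k. of_bool (t' = t) * \<phi> (TypeNode t' k, Cluster k)) = \<phi> (TypeNode t k, Cluster k)"
    using t finite_types[OF I] by (simp add: of_bool_def if_distrib[of "\<lambda>x. x * _"] cong: if_cong)
  ultimately show ?thesis
    using k unfolding sum_edges_flow_apfr[OF I] incidence_flow_apfr mult.assoc sum_of_bool_const_mult
    by (simp add: type_points_eq[OF I t] sum.inter_filter sum_negf cong: if_cong)
qed

lemma net_outflow_Cluster: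
  assumes I: "apfr_instance I" and k: "k \<in> clusters I"
  shows "(\<Sum>e\<in>edges (flow_apfr I z). incidence (Cluster k) e * \<phi> e)
    = (if k \<in> frac_clusters I z then \<phi> (Cluster k, Sink) else 0)
      - (\<Sum>t\<in>types I k. \<phi> (TypeNode t k, Cluster k))"
proof -
  have "(\<Sum>k'\<in>frac_clusters I z. of_bool (k' = k) * \<phi> (Cluster k', Sink))
      = (if k \<in> frac_clusters I z then \<phi> (Cluster k, Sink) else 0)"
    by (simp add: of_bool_def if_distrib[of "\<lambda>x. x * _"] cong: if_cong)
  then show ?thesis
    using k unfolding sum_edges_flow_apfr[OF I] incidence_flow_apfr mult.assoc sum_of_bool_const_mult
    by (simp add: sum_negf)
qed

lemma net_outflow_Sink:
  assumes I: "apfr_instance I"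
  shows "(\<Sum>e\<in>edges (flow_apfr I z). incidence Sink e * \<phi> e)
    = - (\<Sum>k\<in>frac_clusters I z. \<phi> (Cluster k, Sink))"
  unfolding sum_edges_flow_apfr[OF I] incidence_flow_apfr by (simp add: sum_negf)

lemma flow_cost_flow_apfr:
  assumes I: "apfr_instance I"
  shows "flow_cost (flow_apfr I z) \<phi>
    = assignment_cost I (\<lambda>i k. \<phi> (point_edge I i k))"
  unfolding flow_cost_def sum_edges_flow_apfr[OF I]
  by (simp add: flow_apfr_def point_edge_def assignment_cost_def)

text \<open>With the balance at the type nodes and clusters solved for the inflow, the equations can be
  chained from the data points to the sink.\<close>

lemma feasible_flow_apfr_iff:
  fixes \<phi> :: "('f, 'g) node \<times> ('f, 'g) node \<Rightarrow> real"
  assumes I: "apfr_instance (I :: ('f, 'g, 'm::finite) apfr)"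
  shows "feasible_flow (flow_apfr I z) \<phi> \<longleftrightarrow>
    (\<forall>e\<in>edges (flow_apfr I z). 0 \<le> \<phi> e \<and> \<phi> e \<le> 1) \<and>
    (\<forall>i\<in>data_points I. (\<Sum>k\<in>clusters I. \<phi> (point_edge I i k)) = 1) \<and>
    (\<forall>k\<in>clusters I. \<forall>t\<in>types I k.
       (\<Sum>i\<in>type_points I k t. \<phi> (point_edge I i k))
         = real_of_int (type_demand I z t k) + \<phi> (TypeNode t k, Cluster k)) \<and>
    (\<forall>k\<in>clusters I. (\<Sum>t\<in>types I k. \<phi> (TypeNode t k, Cluster k))
         = real_of_int (cluster_demand I z k) + (if k \<in> frac_clusters I z then \<phi> (Cluster k, Sink) else 0)) \<and>
    (\<Sum>k\<in>frac_clusters I z. \<phi> (Cluster k, Sink)) = real_of_int (sink_demand I z)"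
proof -
  let ?N = "flow_apfr I z"
  let ?net = "\<lambda>v. (\<Sum>e\<in>edges ?N. incidence v e * \<phi> e)"
  have "(\<forall>v\<in>nodes ?N. P v) \<longleftrightarrow>
    (\<forall>i\<in>data_points I. P (Point i)) \<and>
    (\<forall>k\<in>clusters I. \<forall>t\<in>types I k. P (TypeNode t k)) \<and>
    (\<forall>k\<in>clusters I. P (Cluster k)) \<and> P Sink" for P
    by (auto simp: flow_apfr_def)
  note all_nodes = this[of "\<lambda>v. ?net v = net_supply ?N v"]
  have sup: "net_supply ?N (Point i) = 1"
    "net_supply ?N (TypeNode t k) = - real_of_int (type_demand I z t k)"
    "net_supply ?N (Cluster k) = - real_of_int (cluster_demand I z k)"
    "net_supply ?N Sink = - real_of_int (sink_demand I z)" and cap: "capacity ?N e = 1" for i t k e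
    by (simp_all add: flow_apfr_def)
  have eqs: "a - b = - d \<longleftrightarrow> b = d + a" "- b = - d \<longleftrightarrow> b = d" for a b d :: real
    by linarith+
  show ?thesis
    unfolding feasible_flow_incidence[OF finite_edges_flow_apfr[OF I]] all_nodes sup cap net_outflow_Sink[OF I]
    by (simp add: net_outflow_Point[OF I] net_outflow_TypeNode[OF I] net_outflow_Cluster[OF I] eqs
        cong: conj_cong ball_cong)
qed

section \<open>From flows to assignments\<close>

text \<open>The fractional assignment read as a flow: each type node keeps the integral part of what it
  receives as its demand and passes the fractional part on to its cluster, which in turn passes the
  fractional part of its total to the sink.\<close>

definition fractional_flow ::
  "('f, 'g, 'm::finite) apfr \<Rightarrow> (nat \<Rightarrow> nat \<Rightarrow> real) \<Rightarrow> ('f, 'g) node \<times> ('f, 'g) node \<Rightarrow> real" where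
  "fractional_flow I z e = (case e of
       (Point i, TypeNode t k) \<Rightarrow> z i k
     | (TypeNode t k, Cluster k') \<Rightarrow> frac (\<Sum>i\<in>type_points I k t. z i k)
     | (Cluster k, Sink) \<Rightarrow> frac (\<Sum>i\<in>data_points I. z i k)
     | _ \<Rightarrow> 0)"

lemma fractional_flow_simps:
  "fractional_flow I z (point_edge I i k) = z i k"
  "fractional_flow I z (TypeNode t k, Cluster k) = frac (\<Sum>i\<in>type_points I k t. z i k)"
  "fractional_flow I z (Cluster k, Sink) = frac (\<Sum>i\<in>data_points I. z i k)"
  by (simp_all add: fractional_flow_def point_edge_def)

text \<open>The demands are the floors, so passing on the fractional parts balances the type nodes. At
  a cluster the type demands cancel and the fractional part of the whole cluster remains; it vanishes
  exactly when the edge to the sink is absent. At the sink the balance is the total mass, which is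
  the number of data points.\<close>

lemma fractional_flow_feasible:
  assumes I: "apfr_instance I"
    and one: "\<forall>i\<in>data_points I. (\<Sum>k\<in>clusters I. z i k) = 1"
    and unit: "\<forall>i\<in>data_points I. \<forall>k\<in>clusters I. z i k \<in> {0..1}"
  shows "feasible_flow (flow_apfr I z) (fractional_flow I z)"
  unfolding feasible_flow_apfr_iff[OF I] fractional_flow_simps
proof (intro conjI ballI)
  fix e assume e: "e \<in> edges (flow_apfr I z)"
  then show "0 \<le> fractional_flow I z e"
    unfolding edges_flow_apfr[OF I] using unit by (auto simp: fractional_flow_simps frac_ge_0)
  show "fractional_flow I z e \<le> 1"
    using e unfolding edges_flow_apfr[OF I]
    using unit by (auto simp: fractional_flow_simps less_imp_le[OF frac_lt_1])
next
  fix i assume "i \<in> data_points I"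
  then show "(\<Sum>k\<in>clusters I. z i k) = 1"
    using one by blast
next
  fix k t
  show "(\<Sum>i\<in>type_points I k t. z i k) = real_of_int (type_demand I z t k) + frac (\<Sum>i\<in>type_points I k t. z i k)"
    by (simp add: type_demand_def frac_def)
next
  fix k assume k: "k \<in> clusters I"
  have "(\<Sum>t\<in>types I k. frac (\<Sum>i\<in>type_points I k t. z i k))
      = (\<Sum>i\<in>data_points I. z i k) - (\<Sum>t\<in>types I k. real_of_int (type_demand I z t k))"
    by (simp add: frac_def sum_subtractf sum_over_types[OF I k] type_demand_def)
  then show "(\<Sum>t\<in>types I k. frac (\<Sum>i\<in>type_points I k t. z i k)) = real_of_int (cluster_demand I z k)
      + (if k \<in> frac_clusters I z then frac (\<Sum>i\<in>data_points I. z i k) else 0)"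
    using k by (auto simp: cluster_demand_def frac_def)
next
  have "(\<Sum>k\<in>frac_clusters I z. frac (\<Sum>i\<in>data_points I. z i k))
      = (\<Sum>k\<in>clusters I. frac (\<Sum>i\<in>data_points I. z i k))"
    by (intro sum.mono_neutral_left) auto
  also have "\<dots> = (\<Sum>i\<in>data_points I. \<Sum>k\<in>clusters I. z i k)
      - (\<Sum>k\<in>clusters I. real_of_int \<lfloor>\<Sum>i\<in>data_points I. z i k\<rfloor>)"
    by (subst sum.swap) (simp add: frac_def sum_subtractf)
  also have "\<dots> = real_of_int (sink_demand I z)"
    using one by (simp add: sink_demand_def cluster_demand_def)
  finally show "(\<Sum>k\<in>frac_clusters I z. frac (\<Sum>i\<in>data_points I. z i k)) = real_of_int (sink_demand I z)" .
qed

lemma integral_flow_zero_or_one: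
  assumes I: "apfr_instance I"
    and feas: "feasible_flow (flow_apfr I z) \<phi>" and int: "integral_flow (flow_apfr I z) \<phi>"
    and e: "e \<in> edges (flow_apfr I z)"
  shows "\<phi> e = 0 \<or> \<phi> e = 1"
proof -
  obtain m where m: "\<phi> e = of_int m"
    using int e by (auto simp: integral_flow_def elim: Ints_cases)
  have "0 \<le> \<phi> e" "\<phi> e \<le> 1"
    using feas e by (auto simp: feasible_flow_apfr_iff[OF I])
  then have "m = 0 \<or> m = 1"
    by (auto simp: m)
  then show ?thesis
    using m by auto
qed

lemma flow_assignment_eq:
  assumes I: "apfr_instance I"
    and feas: "feasible_flow (flow_apfr I z) \<phi>" and int: "integral_flow (flow_apfr I z) \<phi>"
    and i: "i \<in> data_points I" and k: "k \<in> clusters I"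
  shows "flow_assignment I \<phi> i k = \<phi> (point_edge I i k)"
proof -
  have iff: "(\<exists>t\<in>types I k. i \<in> type_points I k t \<and> \<phi> (Point i, TypeNode t k) = 1)
      \<longleftrightarrow> \<phi> (point_edge I i k) = 1"
    using type_of_in_types[OF I i k] type_points_iff_type_of[OF I _ i] by (auto simp: point_edge_def)
  have "point_edge I i k \<in> edges (flow_apfr I z)"
    using i k by (auto simp: edges_flow_apfr[OF I])
  then have "\<phi> (point_edge I i k) = 0 \<or> \<phi> (point_edge I i k) = 1"
    by (rule integral_flow_zero_or_one[OF I feas int])
  then show ?thesis
    unfolding flow_assignment_def iff by auto
qed

text \<open>Adding the balances of a cluster and of all its type nodes cancels the flow between them.
  What remains is the rounded-down fractional size plus the flow sent on to the sink, which is at most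
  one unit.\<close>

lemma cluster_size_of_flow:
  assumes I: "apfr_instance I" and feas: "feasible_flow (flow_apfr I z) \<phi>" and k: "k \<in> clusters I"
  shows "(\<Sum>i\<in>data_points I. \<phi> (point_edge I i k))
    = real_of_int \<lfloor>\<Sum>i\<in>data_points I. z i k\<rfloor> + (if k \<in> frac_clusters I z then \<phi> (Cluster k, Sink) else 0)"
proof -
  note flow = feas[unfolded feasible_flow_apfr_iff[OF I]]
  have "(\<Sum>i\<in>data_points I. \<phi> (point_edge I i k))
      = (\<Sum>t\<in>types I k. \<Sum>i\<in>type_points I k t. \<phi> (point_edge I i k))"
    by (rule sum_over_types[OF I k, symmetric])
  also have "\<dots> = (\<Sum>t\<in>types I k. real_of_int (type_demand I z t k) + \<phi> (TypeNode t k, Cluster k))"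
    using flow k by (intro sum.cong) auto
  also have "\<dots> = (\<Sum>t\<in>types I k. real_of_int (type_demand I z t k)) + (\<Sum>t\<in>types I k. \<phi> (TypeNode t k, Cluster k))"
    by (simp add: sum.distrib)
  also have "(\<Sum>t\<in>types I k. \<phi> (TypeNode t k, Cluster k))
      = real_of_int (cluster_demand I z k) + (if k \<in> frac_clusters I z then \<phi> (Cluster k, Sink) else 0)"
    using flow k by blast
  finally show ?thesis
    by (simp add: cluster_demand_def)
qed

lemma integral_min_cost_flow_apfr_exists:
  assumes I: "apfr_instance I" and feas: "feasible_flow (flow_apfr I z) \<psi>"
  shows "\<exists>\<phi>. min_cost_flow (flow_apfr I z) \<phi> \<and> integral_flow (flow_apfr I z) \<phi>"
proof (rule integral_min_cost_flow_exists[OF finite_edges_flow_apfr[OF I] _ _ _ feas])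
  show "edges (flow_apfr I z) \<subseteq> nodes (flow_apfr I z) \<times> nodes (flow_apfr I z)"
    by (auto simp: flow_apfr_def type_points_def)
  show "\<forall>e\<in>edges (flow_apfr I z). capacity (flow_apfr I z) e \<in> \<int>"
    by (simp add: flow_apfr_def)
  show "\<forall>v\<in>nodes (flow_apfr I z). net_supply (flow_apfr I z) v \<in> \<int>"
    by (auto simp: flow_apfr_def)
qed

theorem theorem5:
  fixes I :: "('f, 'g, 'm :: finite) apfr"
    and zLP :: "nat \<Rightarrow> nat \<Rightarrow> real"
  assumes "apfr_instance I"
    and "lp_optimal I zLP"
  shows "(\<exists>\<phi>. min_cost_flow (flow_apfr I zLP) \<phi> \<and> integral_flow (flow_apfr I zLP) \<phi>) \<and>
    (\<forall>\<phi> z. min_cost_flow (flow_apfr I zLP) \<phi> \<longrightarrow> integral_flow (flow_apfr I zLP) \<phi> \<longrightarrow>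
       z = flow_assignment I \<phi> \<longrightarrow>
       (\<forall>i\<in>data_points I. \<forall>k\<in>clusters I. z i k \<in> {0, 1}) \<and>
       (\<forall>i\<in>data_points I. (\<Sum>k\<in>clusters I. z i k) = 1) \<and>
       (\<forall>k\<in>clusters I. real (lower I) \<le> (\<Sum>i\<in>data_points I. z i k) \<and>
          (\<Sum>i\<in>data_points I. z i k) \<le> real (upper I)) \<and>
       assignment_cost I z \<le> assignment_cost I zLP)"
proof (rule conjI)
  note I = assms(1)
  have LP: "apfr_feasible I {0..1} zLP"
    using assms(2) by (simp add: lp_optimal_def)
  have \<psi>: "feasible_flow (flow_apfr I zLP) (fractional_flow I zLP)"
    using LP by (intro fractional_flow_feasible[OF I]) (simp_all add: apfr_feasible_def)
  show "\<exists>\<phi>. min_cost_flow (flow_apfr I zLP) \<phi> \<and> integral_flow (flow_apfr I zLP) \<phi>"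
    by (rule integral_min_cost_flow_apfr_exists[OF I \<psi>])
  show "\<forall>\<phi> z. min_cost_flow (flow_apfr I zLP) \<phi> \<longrightarrow> integral_flow (flow_apfr I zLP) \<phi> \<longrightarrow>
       z = flow_assignment I \<phi> \<longrightarrow>
       (\<forall>i\<in>data_points I. \<forall>k\<in>clusters I. z i k \<in> {0, 1}) \<and>
       (\<forall>i\<in>data_points I. (\<Sum>k\<in>clusters I. z i k) = 1) \<and>
       (\<forall>k\<in>clusters I. real (lower I) \<le> (\<Sum>i\<in>data_points I. z i k) \<and>
          (\<Sum>i\<in>data_points I. z i k) \<le> real (upper I)) \<and>
       assignment_cost I z \<le> assignment_cost I zLP"
  proof (intro allI impI)
    fix \<phi> z
    assume min: "min_cost_flow (flow_apfr I zLP) \<phi>" and int: "integral_flow (flow_apfr I zLP) \<phi>"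
      and z: "z = flow_assignment I \<phi>"
    have feas: "feasible_flow (flow_apfr I zLP) \<phi>"
      using min by (simp add: min_cost_flow_def)
    have z_eq: "z i k = \<phi> (point_edge I i k)" if "i \<in> data_points I" "k \<in> clusters I" for i k
      using flow_assignment_eq[OF I feas int that] by (simp add: z)
    have one: "(\<Sum>k\<in>clusters I. z i k) = 1" if "i \<in> data_points I" for i
      using feas that by (simp add: feasible_flow_apfr_iff[OF I] z_eq)
    have card: "real (lower I) \<le> (\<Sum>i\<in>data_points I. z i k) \<and>
          (\<Sum>i\<in>data_points I. z i k) \<le> real (upper I)" if k: "k \<in> clusters I" for k
    proof -
      define S where "S = (\<Sum>i\<in>data_points I. zLP i k)"
      have bounds: "real (lower I) \<le> S" "S \<le> real (upper I)"
        using LP k by (simp_all add: apfr_feasible_def S_def)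
      have size: "(\<Sum>i\<in>data_points I. z i k)
          = real_of_int \<lfloor>S\<rfloor> + (if k \<in> frac_clusters I zLP then \<phi> (Cluster k, Sink) else 0)"
        using cluster_size_of_flow[OF I feas k] k by (simp add: z_eq S_def)
      have "int (lower I) \<le> \<lfloor>S\<rfloor>"
        using bounds(1) by (simp add: le_floor_iff)
      then have low: "real (lower I) \<le> real_of_int \<lfloor>S\<rfloor>"
        by linarith
      show ?thesis
      proof (cases "k \<in> frac_clusters I zLP")
        case True
        then have "(Cluster k, Sink) \<in> edges (flow_apfr I zLP)"
          by (auto simp: edges_flow_apfr[OF I])
        then have \<phi>: "0 \<le> \<phi> (Cluster k, Sink)" "\<phi> (Cluster k, Sink) \<le> 1"
          using feas by (auto simp: feasible_flow_apfr_iff[OF I])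
        \<comment> \<open>a fractional size lies strictly below the integral upper bound, so rounding it up is harmless\<close>
        have "S \<noteq> of_int \<lfloor>S\<rfloor>"
          using True by (metis (mono_tags, lifting) Ints_of_int S_def mem_Collect_eq)
        then have "\<lfloor>S\<rfloor> < int (upper I)"
          using bounds(2) by linarith
        then have "real_of_int \<lfloor>S\<rfloor> + 1 \<le> real (upper I)"
          by linarith
        then show ?thesis
          using size True low \<phi> by simp
      next
        case False
        then have "(\<Sum>i\<in>data_points I. z i k) = real_of_int \<lfloor>S\<rfloor>"
          using size by (simp only: if_False add_0_right)
        then show ?thesis
          using low bounds(2) of_int_floor_le[of S] by linarith
      qed
    qed
    have "assignment_cost I z = flow_cost (flow_apfr I zLP) \<phi>"
      by (simp add: flow_cost_flow_apfr[OF I] assignment_cost_def z_eq)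
    also have "\<dots> \<le> flow_cost (flow_apfr I zLP) (fractional_flow I zLP)"
      using min \<psi> by (simp add: min_cost_flow_def)
    also have "\<dots> = assignment_cost I zLP"
      by (simp add: flow_cost_flow_apfr[OF I] fractional_flow_simps)
    finally show "(\<forall>i\<in>data_points I. \<forall>k\<in>clusters I. z i k \<in> {0, 1}) \<and>
       (\<forall>i\<in>data_points I. (\<Sum>k\<in>clusters I. z i k) = 1) \<and>
       (\<forall>k\<in>clusters I. real (lower I) \<le> (\<Sum>i\<in>data_points I. z i k) \<and>
          (\<Sum>i\<in>data_points I. z i k) \<le> real (upper I)) \<and>
       assignment_cost I z \<le> assignment_cost I zLP"
      using one card by (auto simp: z flow_assignment_def)
  qed
qed

end
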